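(* (Russo's formula.) Let $A$ be an event which depends only on the states of the vertices in a finite set $W\subset V$. Let ${\bf p}\in Q$ and let $\gamma=(\gamma_0,\gamma_1,\dots,\gamma_d):(-\epsilon,\epsilon)\to Q$ be a $C^1$ curve with parameter $t$ such that $\gamma(0)={\bf p}$. Then $$\frac{d}{dt}P_{\gamma(t)}(A)\Big|_{t=0}=\sum_{x\in W}\ \sum_{S\subset L_x}\frac{d\gamma_{|S|}}{dt}(0)\,\frac{P_{\bf p}(A^x_S)}{\binom{d}{|S|}} .$$
   Context: $G=(V,E,o)$ is an infinite simple directed graph with origin $o$: $V$ countably infinite, $E\subset V\times V\setminus\{(x,x)\}$, $(x,y)\in E$ iff $(y,x)\in E$; $L_x=\{y:(x,y)\in E\}$. $G$ is $d$-regular ($|L_x|=d$), connected and vertex-transitive. $Q=\{{\bf p}=(p_0,\dots,p_d)\in\mathbb{R}^{d+1}: p_i\ge0,\ p_0+\cdots+p_d=1\}$. Configurations are $\omega\in\Omega=\prod_{x\in V}2^{L_x}$ with the $\sigma$-field generated by finite-dimensional cylinders (its elements are events); for ${\bf p}\in Q$, $P_{\bf p}$ is the product measure under which the states $\omega(x)\subset L_x$ are independent with $P_{\bf p}(\omega(x)=S)=p_{|S|}/\binom{d}{|S|}$ for $S\subset L_x$. For $\omega\in\Omega$, $x\in V$, $S\subset L_x$, $\omega^x_S$ is the configuration with $\omega^x_S(x)=S$ and $\omega^x_S(y)=\omega(y)$ for $y\ne x$; and $A^x_S=\{\omega\in\Omega:\omega^x_S\in A\}$. *)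

theory Defs
  imports "HOL-Probability.Probability" "Graph_Theory.Graph_Theory"
begin

definition nbrs :: "'v pair_pre_digraph \<Rightarrow> 'v \<Rightarrow> 'v set" where
  "nbrs G x = {y. (x, y) \<in> parcs G}"

text \<open>The directed graphs considered here: \<^locale>\<open>pair_bidirected_digraph\<close> says that the arcs
  are a symmetric irreflexive set of pairs of vertices. The names \<open>connected\<close> and
  \<open>strongly_connected\<close> are qualified because they also denote topological notions.\<close>

locale transitive_digraph = pair_bidirected_digraph G
  for G :: "'v pair_pre_digraph" +
  fixes orig :: 'v and d :: nat
  assumes orig_in_verts: "orig \<in> pverts G"
    and countable_verts: "countable (pverts G)"
    and infinite_verts: "infinite (pverts G)"
    and finite_nbrs: "x \<in> pverts G \<Longrightarrow> finite (nbrs G x)"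
    and regular: "x \<in> pverts G \<Longrightarrow> card (nbrs G x) = d"
    and connected_graph: "Digraph_Component.connected (with_proj G)"
    and vertex_transitive: "\<lbrakk>x \<in> pverts G; y \<in> pverts G\<rbrakk> \<Longrightarrow>
      \<exists>h. pre_digraph.digraph_isomorphism (with_proj G) h \<and>
          app_iso h (with_proj G) = with_proj G \<and> iso_verts h x = y"

text \<open>A point of \<open>\<real>\<^bsup>d+1\<^esup>\<close> is a function on \<open>{0, \<dots>, d}\<close>, extended by \<^const>\<open>undefined\<close>.\<close>

definition param_space :: "nat \<Rightarrow> (nat \<Rightarrow> real) set" where
  "param_space d = {p \<in> {..d} \<rightarrow>\<^sub>E UNIV. (\<forall>i\<le>d. 0 \<le> p i) \<and> (\<Sum>i\<le>d. p i) = 1}"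

definition configs :: "'v pair_pre_digraph \<Rightarrow> ('v \<Rightarrow> 'v set) set" where
  "configs G = (\<Pi>\<^sub>E x\<in>pverts G. Pow (nbrs G x))"

text \<open>The sets of a product space are those generated by the finite-dimensional cylinders.\<close>

definition events :: "'v pair_pre_digraph \<Rightarrow> ('v \<Rightarrow> 'v set) set set" where
  "events G = sets (\<Pi>\<^sub>M x\<in>pverts G. count_space (Pow (nbrs G x)))"

definition state_measure :: "'v pair_pre_digraph \<Rightarrow> nat \<Rightarrow> (nat \<Rightarrow> real) \<Rightarrow> 'v \<Rightarrow> 'v set measure" where
  "state_measure G d p x =
     point_measure (Pow (nbrs G x)) (\<lambda>S. ennreal (p (card S) / real (d choose card S)))"

definition config_measure :: "'v pair_pre_digraph \<Rightarrow> nat \<Rightarrow> (nat \<Rightarrow> real) \<Rightarrow> ('v \<Rightarrow> 'v set) measure" where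
  "config_measure G d p = (\<Pi>\<^sub>M x\<in>pverts G. state_measure G d p x)"

definition forced_event ::
  "'v pair_pre_digraph \<Rightarrow> ('v \<Rightarrow> 'v set) set \<Rightarrow> 'v \<Rightarrow> 'v set \<Rightarrow> ('v \<Rightarrow> 'v set) set" where
  "forced_event G A x S = {\<sigma> \<in> configs G. \<sigma>(x := S) \<in> A}"

definition depends_only_on ::
  "'v pair_pre_digraph \<Rightarrow> ('v \<Rightarrow> 'v set) set \<Rightarrow> 'v set \<Rightarrow> bool" where
  "depends_only_on G A W \<longleftrightarrow>
     (\<forall>\<sigma>\<in>configs G. \<forall>\<sigma>'\<in>configs G. (\<forall>x\<in>W. \<sigma> x = \<sigma>' x) \<longrightarrow> (\<sigma> \<in> A \<longleftrightarrow> \<sigma>' \<in> A))"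

end

theory Submission
  imports Defs
begin

text \<open>An event that depends only on the finite set \<open>W\<close> is a finite union of cylinders over \<open>W\<close>, so
  its probability is a polynomial in the parameters, namely the sum over the local patterns \<open>c\<close> of
  the products over \<open>x \<in> W\<close> of the weights of \<open>c x\<close>. By the product rule its derivative is a sum
  over \<open>c\<close> and \<open>x\<close>; sorting the patterns by the value \<open>S = c x\<close>, the remaining products over
  \<open>W - {x}\<close> add up to the probability of the event with the state of \<open>x\<close> forced to be \<open>S\<close>, since
  that event depends only on \<open>W - {x}\<close>.\<close>

text \<open>The cylinders over the single points of the finite base are disjoint, and each is a box
  of singletons, so finite additivity combines with the product formula for boxes.\<close>

lemma (in product_prob_space) measure_PiM_emb_finite:
  assumes J: "J \<subseteq> I" "finite J" and "finite B" and B: "B \<subseteq> (\<Pi>\<^sub>E j\<in>J. space (M j))"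
    and singleton: "\<And>j a. j \<in> J \<Longrightarrow> a \<in> space (M j) \<Longrightarrow> {a} \<in> sets (M j)"
  shows "measure (PiM I M) (prod_emb I M J B) = (\<Sum>c\<in>B. \<Prod>j\<in>J. measure (M j) {c j})"
proof -
  let ?cyl = "\<lambda>c. prod_emb I M J (\<Pi>\<^sub>E j\<in>J. {c j})"
  \<comment> \<open>Elements of \<open>B\<close> are \<open>undefined\<close> off \<open>J\<close>,
    so their values on \<open>J\<close> determine them.\<close>
  have cyl: "(\<Pi>\<^sub>E j\<in>J. {c j}) = {c}" if "c \<in> B" for c
    using B that by (intro PiE_singleton) (auto simp: PiE_def)
  have sets: "{c j} \<in> sets (M j)" if "c \<in> B" "j \<in> J" for c j
    using B that by (intro singleton) auto
  have "prod_emb I M J B = (\<Union>c\<in>B. ?cyl c)"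
    using cyl by (auto simp: prod_emb_def)
  also have "measure (PiM I M) \<dots> = (\<Sum>c\<in>B. measure (PiM I M) (?cyl c))"
  proof (rule P.finite_measure_finite_Union)
    show "?cyl ` B \<subseteq> P.events"
      using J sets by (auto intro!: sets_PiM_I)
    show "disjoint_family_on ?cyl B"
      using cyl by (auto simp: disjoint_family_on_def prod_emb_def)
  qed fact
  also have "\<dots> = (\<Sum>c\<in>B. \<Prod>j\<in>J. measure (M j) {c j})"
    using J sets by (intro sum.cong measure_PiM_emb) auto
  finally show ?thesis .
qed

text \<open>The subsets of size \<open>i\<close> number exactly \<open>card L choose i\<close>,
  which cancels the denominator. With the weights of a parameter point this yields total mass 1 for
  the state of a vertex.\<close>

lemma sum_Pow_card:
  fixes f :: "nat \<Rightarrow> real"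
  assumes "finite L"
  shows "(\<Sum>S\<in>Pow L. f (card S) / real (card L choose card S)) = (\<Sum>i\<le>card L. f i)"
proof -
  have "(\<Sum>S\<in>Pow L. f (card S) / real (card L choose card S)) =
      (\<Sum>i\<le>card L. \<Sum>S\<in>{S \<in> Pow L. card S = i}. f (card S) / real (card L choose card S))"
    using assms by (intro sum.group [symmetric]) (auto simp: card_mono)
  also have "\<dots> = (\<Sum>i\<le>card L. f i)"
  proof (rule sum.cong)
    fix i assume "i \<in> {..card L}"
    then show "(\<Sum>S\<in>{S \<in> Pow L. card S = i}. f (card S) / real (card L choose card S)) = f i"
      using n_subsets [OF assms, of i] by simp
  qed simp
  finally show ?thesis .
qed

lemma configs_fun_upd:
  assumes "\<sigma> \<in> configs G" "x \<in> pverts G" "S \<subseteq> nbrs G x"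
  shows "\<sigma>(x := S) \<in> configs G"
  using assms unfolding configs_def by (auto simp: PiE_iff extensional_def)

text \<open>Overwriting the state at \<open>x\<close> erases any disagreement there, so agreement on
  the rest of \<open>W\<close> is enough.\<close>

lemma depends_only_on_forced_event:
  assumes "depends_only_on G A W" "x \<in> pverts G" "S \<subseteq> nbrs G x"
  shows "depends_only_on G (forced_event G A x S) (W - {x})"
  unfolding depends_only_on_def
proof (intro ballI impI)
  fix \<sigma> \<sigma>'
  assume \<sigma>: "\<sigma> \<in> configs G" "\<sigma>' \<in> configs G" and eq: "\<forall>y\<in>W - {x}. \<sigma> y = \<sigma>' y"
  have "\<forall>y\<in>W. (\<sigma>(x := S)) y = (\<sigma>'(x := S)) y"
    using eq by simp
  then have "\<sigma>(x := S) \<in> A \<longleftrightarrow> \<sigma>'(x := S) \<in> A"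
    using assms(1) configs_fun_upd [OF \<sigma>(1) assms(2,3)] configs_fun_upd [OF \<sigma>(2) assms(2,3)]
    unfolding depends_only_on_def by blast
  then show "\<sigma> \<in> forced_event G A x S \<longleftrightarrow> \<sigma>' \<in> forced_event G A x S"
    using \<sigma> by (simp add: forced_event_def)
qed

lemma events_subset_configs:
  assumes "A \<in> events G"
  shows "A \<subseteq> configs G"
  using sets.sets_into_space [OF assms [unfolded events_def]]
  by (simp add: space_PiM configs_def)

text \<open>The index set of the polynomial. Values off \<open>W\<close> become
  \<open>undefined\<close>, so configurations that agree on \<open>W\<close> give the same pattern
  and are counted once.\<close>

definition patterns :: "('v \<Rightarrow> 'v set) set \<Rightarrow> 'v set \<Rightarrow> ('v \<Rightarrow> 'v set) set" where
  "patterns A W = (\<lambda>\<sigma>. restrict \<sigma> W) ` A"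

lemma patterns_subset:
  assumes "A \<subseteq> configs G" "W \<subseteq> pverts G"
  shows "patterns A W \<subseteq> (\<Pi>\<^sub>E x\<in>W. Pow (nbrs G x))"
  using assms unfolding patterns_def configs_def by (fastforce simp: PiE_iff)

text \<open>Deleting the entry at \<open>x\<close> and filling in \<open>S\<close> there are
  mutually inverse, and neither changes the factors over \<open>W - {x}\<close>.\<close>

lemma sum_patterns_fibre:
  fixes h :: "'v \<Rightarrow> 'v set \<Rightarrow> real"
  assumes "A \<subseteq> configs G" "x \<in> W"
  shows "(\<Sum>c\<in>{c \<in> patterns A W. c x = S}. \<Prod>y\<in>W - {x}. h y (c y)) =
    (\<Sum>c\<in>patterns (forced_event G A x S) (W - {x}). \<Prod>y\<in>W - {x}. h y (c y))"
proof (rule sum.reindex_bij_witness [where i = "\<lambda>c. c(x := S)" and j = "\<lambda>c. restrict c (W - {x})"])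
  fix c assume "c \<in> {c \<in> patterns A W. c x = S}"
  then obtain \<sigma> where \<sigma>: "\<sigma> \<in> A" "c = restrict \<sigma> W" "\<sigma> x = S"
    using \<open>x \<in> W\<close> by (auto simp: patterns_def)
  \<comment> \<open>Since \<open>\<sigma> x = S\<close>, forcing the state at \<open>x\<close>
    leaves \<open>\<sigma>\<close> unchanged.\<close>
  then have "\<sigma> \<in> forced_event G A x S"
    using assms by (auto simp: forced_event_def)
  moreover have "restrict c (W - {x}) = restrict \<sigma> (W - {x})"
    using \<sigma> by (auto simp: fun_eq_iff)
  ultimately show "restrict c (W - {x}) \<in> patterns (forced_event G A x S) (W - {x})"
    by (auto simp: patterns_def)
  show "(restrict c (W - {x}))(x := S) = c"
    using \<sigma> \<open>x \<in> W\<close> by (auto simp: fun_eq_iff)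
  show "(\<Prod>y\<in>W - {x}. h y (restrict c (W - {x}) y)) = (\<Prod>y\<in>W - {x}. h y (c y))"
    by (intro prod.cong) auto
next
  fix c assume "c \<in> patterns (forced_event G A x S) (W - {x})"
  then obtain \<sigma> where \<sigma>: "\<sigma>(x := S) \<in> A" "c = restrict \<sigma> (W - {x})"
    by (auto simp: patterns_def forced_event_def)
  \<comment> \<open>The configuration in \<open>A\<close> behind the filled pattern is
    \<open>\<sigma>(x := S)\<close>; \<open>\<sigma>\<close> itself may lie outside
    \<open>A\<close>.\<close>
  then have "c(x := S) = restrict (\<sigma>(x := S)) W"
    using \<open>x \<in> W\<close> by (auto simp: fun_eq_iff)
  then show "c(x := S) \<in> {c \<in> patterns A W. c x = S}"
    using \<sigma>(1) \<open>x \<in> W\<close> by (simp add: patterns_def)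
  show "restrict (c(x := S)) (W - {x}) = c"
    using \<sigma> by (auto simp: fun_eq_iff)
qed

context transitive_digraph
begin

lemma emeasure_state_measure:
  assumes "p \<in> param_space d" "x \<in> pverts G" "X \<subseteq> Pow (nbrs G x)"
  shows "emeasure (state_measure G d p x) X =
    ennreal (\<Sum>S\<in>X. p (card S) / real (d choose card S))"
proof -
  \<comment> \<open>\<open>ennreal\<close> sends negative numbers to 0, so it commutes with the sum
    only for nonnegative terms; \<open>param_space\<close> controls the coordinates only up to index
    \<open>d\<close>.\<close>
  have "0 \<le> p (card S)" if "S \<in> X" for S
  proof -
    have "card S \<le> d"
      using that assms(3) card_mono [OF finite_nbrs [OF assms(2)]] regular [OF assms(2)] by auto
    then show ?thesis
      using assms(1) by (simp add: param_space_def)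
  qed
  then show ?thesis
    using finite_nbrs [OF assms(2)] assms(3) unfolding state_measure_def
    by (subst emeasure_point_measure_finite) (auto intro!: sum_ennreal)
qed

lemma prob_space_state_measure:
  assumes "p \<in> param_space d" "x \<in> pverts G"
  shows "prob_space (state_measure G d p x)"
proof
  have "space (state_measure G d p x) = Pow (nbrs G x)"
    by (simp add: state_measure_def space_point_measure)
  then show "emeasure (state_measure G d p x) (space (state_measure G d p x)) = 1"
    using emeasure_state_measure [OF assms order_refl] sum_Pow_card [OF finite_nbrs [OF assms(2)], of p]
      regular [OF assms(2)] assms(1)
    by (simp add: param_space_def)
qed

text \<open>The set \<open>A\<close> is the cylinder over \<open>W\<close> with base
  \<open>patterns A W\<close>, and this base is finite. Stating this for any set of configurations
  that depends only on \<open>W\<close> lets it cover the forced events as well.\<close>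

lemma measure_config_measure:
  assumes p: "p \<in> param_space d" and A: "A \<subseteq> configs G" "depends_only_on G A W"
    and W: "finite W" "W \<subseteq> pverts G"
  shows "measure (config_measure G d p) A =
    (\<Sum>c\<in>patterns A W. \<Prod>x\<in>W. p (card (c x)) / real (d choose card (c x)))"
proof -
  \<comment> \<open>The locale for product measures wants probability spaces at all indices; outside
    the vertex set \<^const>\<open>state_measure\<close> need not be one.\<close>
  define M where "M x = (if x \<in> pverts G then state_measure G d p x else return (count_space UNIV) {})" for x
  interpret product_prob_space M "pverts G"
    using p by (intro product_prob_spaceI) (auto simp: M_def prob_space_state_measure prob_space_return)
  have config: "config_measure G d p = PiM (pverts G) M"
    unfolding config_measure_def by (intro PiM_cong) (auto simp: M_def)
  have space: "space (M x) = Pow (nbrs G x)" and sets: "sets (M x) = Pow (Pow (nbrs G x))"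
    if "x \<in> pverts G" for x
    using that by (simp_all add: M_def state_measure_def space_point_measure sets_point_measure)
  have sub: "patterns A W \<subseteq> (\<Pi>\<^sub>E x\<in>W. Pow (nbrs G x))"
    using A W by (intro patterns_subset)
  then have fin: "finite (patterns A W)"
    using W finite_nbrs by (elim finite_subset) (auto intro!: finite_PiE)
  have "A = prod_emb (pverts G) M W (patterns A W)"
  proof (intro set_eqI iffI)
    fix \<sigma> assume "\<sigma> \<in> A"
    then show "\<sigma> \<in> prod_emb (pverts G) M W (patterns A W)"
      using A space by (auto simp: prod_emb_iff patterns_def configs_def PiE_iff)
  next
    \<comment> \<open>Here dependence on \<open>W\<close> enters: \<open>\<sigma>\<close> agrees on
      \<open>W\<close> with some member of \<open>A\<close>, hence belongs to \<open>A\<close>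
      itself.\<close>
    fix \<sigma> assume \<sigma>: "\<sigma> \<in> prod_emb (pverts G) M W (patterns A W)"
    then obtain \<sigma>' where \<sigma>': "\<sigma>' \<in> A" "restrict \<sigma> W = restrict \<sigma>' W"
      by (auto simp: prod_emb_iff patterns_def)
    moreover have "\<sigma> \<in> configs G"
      using \<sigma> space by (auto simp: prod_emb_iff configs_def PiE_iff)
    moreover have "\<sigma> x = \<sigma>' x" if "x \<in> W" for x
      using fun_cong [OF \<sigma>'(2), of x] that by simp
    ultimately show "\<sigma> \<in> A"
      using A unfolding depends_only_on_def by blast
  qed
  then have "measure (config_measure G d p) A =
      measure (PiM (pverts G) M) (prod_emb (pverts G) M W (patterns A W))"
    by (simp add: config)
  also have "\<dots> = (\<Sum>c\<in>patterns A W. \<Prod>x\<in>W. measure (M x) {c x})"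
    using W fin sub space sets by (intro measure_PiM_emb_finite) (auto simp: PiE_iff subset_iff)
  also have "\<dots> = (\<Sum>c\<in>patterns A W. \<Prod>x\<in>W. p (card (c x)) / real (d choose card (c x)))"
  proof (intro sum.cong prod.cong refl)
    fix c x assume c: "c \<in> patterns A W" and x: "x \<in> W"
    have "x \<in> pverts G" "c x \<subseteq> nbrs G x"
      using c x sub W by (auto simp: PiE_iff subset_iff)
    moreover from this have "card (c x) \<le> d"
      using card_mono [OF finite_nbrs] regular by metis
    \<comment> \<open>Passing from \<open>emeasure\<close> back to a real number recovers the weight
      only if it is nonnegative.\<close>
    then have "0 \<le> p (card (c x))"
      using p by (simp add: param_space_def)
    ultimately show "measure (M x) {c x} = p (card (c x)) / real (d choose card (c x))"
      using emeasure_state_measure [OF p, of x "{c x}"]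
      by (simp add: M_def measure_def)
  qed
  finally show ?thesis .
qed

end

theorem theorem12:
  fixes G :: "'v pair_pre_digraph" and orig :: 'v and d :: nat
    and A :: "('v \<Rightarrow> 'v set) set" and W :: "'v set"
    and p :: "nat \<Rightarrow> real" and \<gamma> :: "real \<Rightarrow> nat \<Rightarrow> real" and \<epsilon> :: real
  assumes "transitive_digraph G orig d"
    and "A \<in> events G"
    and "finite W" and "W \<subseteq> pverts G"
    and "depends_only_on G A W"
    and "p \<in> param_space d"
    and "\<epsilon> > 0"
    and "\<And>t. t \<in> {-\<epsilon><..<\<epsilon>} \<Longrightarrow> \<gamma> t \<in> param_space d"
    and "\<And>i. i \<le> d \<Longrightarrow> (\<lambda>t. \<gamma> t i) C1_differentiable_on {-\<epsilon><..<\<epsilon>}"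
    and "\<gamma> 0 = p"
  shows "((\<lambda>t. measure (config_measure G d (\<gamma> t)) A) has_real_derivative
           (\<Sum>x\<in>W. \<Sum>S\<in>Pow (nbrs G x).
              deriv (\<lambda>t. \<gamma> t (card S)) 0 *
              (measure (config_measure G d p) (forced_event G A x S) / real (d choose card S))))
         (at 0)"
proof -
  interpret transitive_digraph G orig d by fact
  define w where "w t S = \<gamma> t (card S) / real (d choose card S)" for t and S :: "'v set"
  define w' where "w' S = deriv (\<lambda>t. \<gamma> t (card S)) 0 / real (d choose card S)" for S :: "'v set"
  have A: "A \<subseteq> configs G"
    using \<open>A \<in> events G\<close> by (rule events_subset_configs)
  have sub: "patterns A W \<subseteq> (\<Pi>\<^sub>E x\<in>W. Pow (nbrs G x))"
    using A \<open>W \<subseteq> pverts G\<close> by (rule patterns_subset)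
  then have fin: "finite (patterns A W)"
    using \<open>finite W\<close> \<open>W \<subseteq> pverts G\<close> finite_nbrs by (elim finite_subset) (auto intro!: finite_PiE)
  \<comment> \<open>Used twice: for \<open>A\<close> with \<open>U = W\<close> at all
    \<open>t\<close> near 0, and for forced events with \<open>U = W - {x}\<close> at
    \<open>t = 0\<close>.\<close>
  have meas: "measure (config_measure G d (\<gamma> t)) B = (\<Sum>c\<in>patterns B U. \<Prod>x\<in>U. w t (c x))"
    if "t \<in> {-\<epsilon><..<\<epsilon>}" "B \<subseteq> configs G" "depends_only_on G B U" "U \<subseteq> W" for t B U
    unfolding w_def using that assms(3,4,8) finite_subset
    by (intro measure_config_measure) auto
  have w': "((\<lambda>t. w t S) has_real_derivative w' S) (at 0)" if "x \<in> W" "S \<subseteq> nbrs G x" for x S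
  proof -
    have "card S \<le> d"
      using that \<open>W \<subseteq> pverts G\<close> card_mono [OF finite_nbrs] regular by (metis subsetD)
    then have "(\<lambda>t. \<gamma> t (card S)) differentiable at 0"
      using assms(9) \<open>\<epsilon> > 0\<close> by (simp add: C1_differentiable_on_eq)
    \<comment> \<open>Differentiability ensures that \<open>deriv\<close> denotes the actual
      derivative and not an unspecified value.\<close>
    then have "((\<lambda>t. \<gamma> t (card S)) has_real_derivative deriv (\<lambda>t. \<gamma> t (card S)) 0) (at 0)"
      using DERIV_deriv_iff_real_differentiable by blast
    then show ?thesis
      unfolding w_def w'_def by (rule DERIV_cdivide)
  qed
  have forced: "(\<Sum>c\<in>{c \<in> patterns A W. c x = S}. \<Prod>y\<in>W - {x}. w 0 (c y)) =
      measure (config_measure G d p) (forced_event G A x S)" if "x \<in> W" "S \<subseteq> nbrs G x" for x S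
  proof -
    have "depends_only_on G (forced_event G A x S) (W - {x})"
      using that assms(4,5) by (intro depends_only_on_forced_event) auto
    then have "measure (config_measure G d p) (forced_event G A x S) =
        (\<Sum>c\<in>patterns (forced_event G A x S) (W - {x}). \<Prod>y\<in>W - {x}. w 0 (c y))"
      using meas [of 0] \<open>\<epsilon> > 0\<close> \<open>\<gamma> 0 = p\<close> by (simp add: forced_event_def)
    then show ?thesis
      using sum_patterns_fibre [OF A \<open>x \<in> W\<close>] by simp
  qed
  have "((\<lambda>t. \<Sum>c\<in>patterns A W. \<Prod>x\<in>W. w t (c x)) has_real_derivative
      (\<Sum>c\<in>patterns A W. \<Sum>x\<in>W. w' (c x) * (\<Prod>y\<in>W - {x}. w 0 (c y)))) (at 0)"
    using sub w' by (intro DERIV_sum has_field_derivative_prod) (auto simp: PiE_iff subset_iff)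
  also have "(\<Sum>c\<in>patterns A W. \<Sum>x\<in>W. w' (c x) * (\<Prod>y\<in>W - {x}. w 0 (c y))) =
      (\<Sum>x\<in>W. \<Sum>c\<in>patterns A W. w' (c x) * (\<Prod>y\<in>W - {x}. w 0 (c y)))"
    by (rule sum.swap)
  also have "\<dots> = (\<Sum>x\<in>W. \<Sum>S\<in>Pow (nbrs G x). deriv (\<lambda>t. \<gamma> t (card S)) 0 *
      (measure (config_measure G d p) (forced_event G A x S) / real (d choose card S)))"
  proof (intro sum.cong refl)
    fix x assume x: "x \<in> W"
    then have "finite (Pow (nbrs G x))" "(\<lambda>c. c x) ` patterns A W \<subseteq> Pow (nbrs G x)"
      using sub finite_nbrs \<open>W \<subseteq> pverts G\<close> by (auto simp: PiE_iff subset_iff)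
    then have "(\<Sum>c\<in>patterns A W. w' (c x) * (\<Prod>y\<in>W - {x}. w 0 (c y))) =
        (\<Sum>S\<in>Pow (nbrs G x). \<Sum>c\<in>{c \<in> patterns A W. c x = S}. w' (c x) * (\<Prod>y\<in>W - {x}. w 0 (c y)))"
      by (intro sum.group [symmetric] fin)
    \<comment> \<open>On each group \<open>c x = S\<close>, so the differentiated factor is constant
      and comes out of the inner sum.\<close>
    also have "\<dots> = (\<Sum>S\<in>Pow (nbrs G x). w' S *
        (\<Sum>c\<in>{c \<in> patterns A W. c x = S}. \<Prod>y\<in>W - {x}. w 0 (c y)))"
      unfolding sum_distrib_left by (intro sum.cong) auto
    also have "\<dots> = (\<Sum>S\<in>Pow (nbrs G x). deriv (\<lambda>t. \<gamma> t (card S)) 0 *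
        (measure (config_measure G d p) (forced_event G A x S) / real (d choose card S)))"
      using forced [OF x] by (intro sum.cong) (auto simp: w'_def)
    finally show "(\<Sum>c\<in>patterns A W. w' (c x) * (\<Prod>y\<in>W - {x}. w 0 (c y))) =
        (\<Sum>S\<in>Pow (nbrs G x). deriv (\<lambda>t. \<gamma> t (card S)) 0 *
        (measure (config_measure G d p) (forced_event G A x S) / real (d choose card S)))" .
  qed
  \<comment> \<open>The probability is known to equal the polynomial only for \<open>t\<close> in
    the interval where the curve is defined; this open neighbourhood of 0 suffices to transfer the
    derivative.\<close>
  finally show ?thesis
  proof (rule has_field_derivative_transform_within_open)
    show "0 \<in> {-\<epsilon><..<\<epsilon>}"
      using \<open>\<epsilon> > 0\<close> by simp
  qed (use meas A assms(5) in auto)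
qed

end
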